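(* Let $G = H\times A$ be a group (not necessarily finite), where $H$ is a purely non-abelian subgroup of $G$ and $A$ is a non-trivial abelian factor of $G$. Then, for every integer $n\geq 2$, there exists a group isomorphism $\phi : Aut_{Z(G)}^{\gamma_{n}(G)}(G) \rightarrow Aut_{Z(H)}^{\gamma_{n}(H)}(H)$ such that $\phi(Aut_{c}^{n-1}(G))=Aut_{c}^{n-1}(H)$.
   Context: $Z(G)$ is the center of $G$ and $\gamma_n(G)$ is the $n$-th term of the lower central series of $G$, with $\gamma_1(G)=G$ and $\gamma_2(G)$ the commutator subgroup. For normal subgroups $M$ and $N$ of $G$: $Aut^{M}(G)$ denotes the group of all automorphisms of $G$ which fix $M$ setwise and act trivially on $G/M$; $Aut_{N}(G)$ denotes the group of all automorphisms of $G$ which fix $N$ elementwise; and $Aut_{N}^{M}(G) = Aut^{M}(G)\cap Aut_{N}(G)$. For $m \geq 1$, an automorphism $\beta$ of $G$ is called $m$-th class preserving if for each $g\in G$ there exists $x\in \gamma_{m}(G)$ (depending on $g$) such that $\beta(g)= x^{-1}gx$; the group of all $m$-th class preserving automorphisms is denoted $Aut_{c}^{m}(G)$. A non-abelian group is called purely non-abelian if it has no non-trivial abelian direct factor. *)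

theory Defs
  imports "HOL-Algebra.Algebra"
begin

text \<open>A subgroup H of a group G, regarded as a group in its own right, is G\<lparr>carrier := H\<rparr>.\<close>

definition group_center :: "('a, 'b) monoid_scheme \<Rightarrow> 'a set" where
  "group_center G = {z \<in> carrier G. \<forall>g \<in> carrier G. z \<otimes>\<^bsub>G\<^esub> g = g \<otimes>\<^bsub>G\<^esub> z}"

text \<open>The commutator convention is that of \<^const>\<open>derived\<close>, so that the commutator subgroup of
  carrier G with itself is literally derived G (carrier G).  For subgroups M and N the other
  convention, with the inverses in front, generates the same subgroup.\<close>

definition commutator_subgroup :: "('a, 'b) monoid_scheme \<Rightarrow> 'a set \<Rightarrow> 'a set \<Rightarrow> 'a set" where
  "commutator_subgroup G M N =
     generate G (\<Union>x \<in> M. \<Union>y \<in> N. {x \<otimes>\<^bsub>G\<^esub> y \<otimes>\<^bsub>G\<^esub> (inv\<^bsub>G\<^esub> x) \<otimes>\<^bsub>G\<^esub> (inv\<^bsub>G\<^esub> y)})"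

text \<open>Indexed from 1; the value at 0 is a dummy.\<close>

fun lower_central :: "('a, 'b) monoid_scheme \<Rightarrow> nat \<Rightarrow> 'a set" where
  "lower_central G 0 = carrier G"
| "lower_central G (Suc 0) = carrier G"
| "lower_central G (Suc (Suc n)) =
     commutator_subgroup G (lower_central G (Suc n)) (carrier G)"

lemma lower_central_2: "lower_central G 2 = derived G (carrier G)"
  by (simp add: numeral_2_eq_2 commutator_subgroup_def derived_def)

definition internal_direct_product :: "('a, 'b) monoid_scheme \<Rightarrow> 'a set \<Rightarrow> 'a set \<Rightarrow> bool" where
  "internal_direct_product G H K \<longleftrightarrow>
     H \<lhd> G \<and> K \<lhd> G \<and> H \<inter> K = {\<one>\<^bsub>G\<^esub>} \<and> H <#>\<^bsub>G\<^esub> K = carrier G"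

definition purely_nonabelian :: "('a, 'b) monoid_scheme \<Rightarrow> bool" where
  "purely_nonabelian G \<longleftrightarrow>
     group G \<and> \<not> comm_group G \<and>
     (\<forall>A K. internal_direct_product G A K \<and> comm_group (G\<lparr>carrier := A\<rparr>) \<longrightarrow> A = {\<one>\<^bsub>G\<^esub>})"

text \<open>An automorphism b with b ` M = M permutes the cosets of M by C \<mapsto> b ` C; this is its
  action on G Mod M.\<close>

definition Aut_quot :: "('a, 'b) monoid_scheme \<Rightarrow> 'a set \<Rightarrow> ('a \<Rightarrow> 'a) set" where
  "Aut_quot G M = {b \<in> auto G. b ` M = M \<and> (\<forall>C \<in> carrier (G Mod M). b ` C = C)}"

definition Aut_fix :: "('a, 'b) monoid_scheme \<Rightarrow> 'a set \<Rightarrow> ('a \<Rightarrow> 'a) set" where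
  "Aut_fix G N = {b \<in> auto G. \<forall>x \<in> N. b x = x}"

definition Aut_quot_fix :: "('a, 'b) monoid_scheme \<Rightarrow> 'a set \<Rightarrow> 'a set \<Rightarrow> ('a \<Rightarrow> 'a) set" where
  "Aut_quot_fix G M N = Aut_quot G M \<inter> Aut_fix G N"

definition Aut_class :: "('a, 'b) monoid_scheme \<Rightarrow> nat \<Rightarrow> ('a \<Rightarrow> 'a) set" where
  "Aut_class G m =
     {b \<in> auto G. \<forall>g \<in> carrier G. \<exists>x \<in> lower_central G m. b g = inv\<^bsub>G\<^esub> x \<otimes>\<^bsub>G\<^esub> g \<otimes>\<^bsub>G\<^esub> x}"

end

theory Submission
  imports Defs
begin

text \<open>Since \<open>A\<close> is central, commutators and conjugation do not see the \<open>A\<close>-components, so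
  \<open>\<gamma>\<^sub>n(G) = \<gamma>\<^sub>n(H)\<close> for \<open>n \<ge> 2\<close>, and \<open>Z(G) = Z(H)A\<close>. An automorphism acting trivially
  modulo \<open>\<gamma>\<^sub>n(G) \<le> H\<close> maps \<open>H\<close> onto itself, and one fixing \<open>Z(G)\<close> elementwise is the identity
  on \<open>A\<close>. So \<open>\<phi>\<close> is restriction to \<open>H\<close>; its inverse sends \<open>c\<close> to \<open>ha \<mapsto> c(h)a\<close>. Both maps
  preserve class preserving automorphisms because \<open>\<gamma>\<^sub>m(H) \<le> \<gamma>\<^sub>m(G) \<le> \<gamma>\<^sub>m(H)A\<close>.\<close>

section \<open>Automorphisms and the lower central series\<close>

context group
begin

lemma commutator_subgroup_is_subgroup:
  assumes "M \<subseteq> carrier G" "N \<subseteq> carrier G"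
  shows "subgroup (commutator_subgroup G M N) G"
  unfolding commutator_subgroup_def
  by (rule generate_is_subgroup) (use assms in blast)

lemma subgroup_lower_central: "subgroup (lower_central G n) G"
proof (induction n rule: nat_less_induct)
  case (1 n)
  show ?case
  proof (cases "n \<le> 1")
    case True
    then have "lower_central G n = carrier G" by (cases n) auto
    then show ?thesis by (simp add: subgroup_self)
  next
    case False
    then have "n = Suc (Suc (n - 2))" by simp
    then obtain k where k: "n = Suc (Suc k)" ..
    have "subgroup (lower_central G (Suc k)) G" using 1 k by blast
    then show ?thesis
      unfolding k by (simp add: commutator_subgroup_is_subgroup subgroup.subset)
  qed
qed

lemma commutator_in_lower_central:
  assumes "x \<in> lower_central G m" "y \<in> carrier G" "m \<ge> 1"
  shows "x \<otimes> y \<otimes> inv x \<otimes> inv y \<in> lower_central G (Suc m)"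
proof -
  obtain k where "m = Suc k" using assms(3) by (cases m) auto
  then show ?thesis
    using assms by (auto simp: commutator_subgroup_def intro!: generate.incl)
qed

text \<open>Trivial action on the cosets means that \<open>b g\<close> stays in
  \<open>M #> g\<close>. The elementwise form is monotone in \<open>M\<close>, which later allows
  \<gamma>_n(G) to be replaced by \<open>H\<close>.\<close>

lemma Aut_quot_eq:
  assumes M: "subgroup M G"
  shows "Aut_quot G M = {b \<in> auto G. \<forall>g \<in> carrier G. b g \<otimes> inv g \<in> M}"
proof (intro Set.set_eqI iffI)
  fix b assume b: "b \<in> Aut_quot G M"
  then have aut: "b \<in> auto G" by (simp add: Aut_quot_def)
  have "b g \<otimes> inv g \<in> M" if g: "g \<in> carrier G" for g
  proof -
    have "M #> g \<in> carrier (G Mod M)" using g by (auto simp: FactGroup_def RCOSETS_def)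
    then have "b ` (M #> g) = M #> g" using b by (auto simp: Aut_quot_def)
    moreover have "g \<in> M #> g" using g M by (rule rcos_self)
    ultimately have "b g \<in> M #> g" by blast
    then obtain x where "x \<in> M" "b g = x \<otimes> g" by (auto simp: r_coset_def)
    moreover have "x \<in> carrier G" using M \<open>x \<in> M\<close> by (rule subgroup.mem_carrier)
    ultimately show ?thesis using g by (simp add: m_assoc)
  qed
  with aut show "b \<in> {b \<in> auto G. \<forall>g \<in> carrier G. b g \<otimes> inv g \<in> M}" by blast
next
  fix b assume "b \<in> {b \<in> auto G. \<forall>g \<in> carrier G. b g \<otimes> inv g \<in> M}"
  then have aut: "b \<in> auto G" and bM: "\<And>g. g \<in> carrier G \<Longrightarrow> b g \<otimes> inv g \<in> M" by auto
  have hom: "b \<in> hom G G" and surj: "b ` carrier G = carrier G"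
    using aut by (auto simp: auto_def Bij_def bij_betw_def)
  have bc: "b g \<in> carrier G" if "g \<in> carrier G" for g using that surj by blast
  \<comment> \<open>The factor \<open>b g \<otimes> inv g\<close> and its inverse lead from
    \<open>g\<close> to \<open>b g\<close> and back, so \<open>b\<close> preserves and reflects
    membership in \<open>M\<close>. With surjectivity, \<open>b\<close> maps \<open>M\<close> onto
    itself.\<close>
  have mem: "b g \<in> M \<longleftrightarrow> g \<in> M" if g: "g \<in> carrier G" for g
  proof
    assume "g \<in> M"
    then have "b g \<otimes> inv g \<otimes> g \<in> M" using bM g M by (blast intro: subgroup.m_closed)
    then show "b g \<in> M" using g bc by (simp add: m_assoc)
  next
    assume "b g \<in> M"
    then have "inv (b g \<otimes> inv g) \<otimes> b g \<in> M"
      using bM g M by (blast intro: subgroup.m_closed subgroup.m_inv_closed)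
    then show "g \<in> M" using g bc by (simp add: inv_mult_group m_assoc)
  qed
  have MG: "M \<subseteq> carrier G" using M by (rule subgroup.subset)
  have img: "b ` M = M"
  proof
    show "b ` M \<subseteq> M" using mem MG by blast
    show "M \<subseteq> b ` M"
    proof
      fix y assume y: "y \<in> M"
      then obtain g where "g \<in> carrier G" "y = b g" using surj MG by blast
      then show "y \<in> b ` M" using mem y by blast
    qed
  qed
  have "b ` C = C" if C: "C \<in> carrier (G Mod M)" for C
  proof -
    obtain g where g: "g \<in> carrier G" "C = M #> g"
      using C by (auto simp: FactGroup_def RCOSETS_def)
    have "b ` (M #> g) = (b ` M) #> b g"
      using hom g MG by (force simp: r_coset_def hom_mult image_iff subset_iff)
    moreover have "b g \<in> M #> g"
    proof -
      have "b g = b g \<otimes> inv g \<otimes> g" using g bc by (simp add: m_assoc)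
      then show ?thesis using bM g by (auto simp: r_coset_def)
    qed
    then have "M #> g = M #> b g" using g M by (intro repr_independence)
    ultimately show ?thesis using img g by simp
  qed
  with aut img show "b \<in> Aut_quot G M" by (simp add: Aut_quot_def)
qed

text \<open>If \<open>b g = inv x \<otimes> g \<otimes> x\<close> with \<open>x\<close> in
  \<gamma>_m(G), then \<open>b g \<otimes> inv g\<close> is the commutator of \<open>inv x\<close>
  and \<open>g\<close>, so it lies in \<gamma>_{m+1}(G). Conjugation fixes central elements.\<close>

lemma Aut_class_subset_Aut_quot_fix:
  assumes m: "m \<ge> 1"
  shows "Aut_class G m \<subseteq> Aut_quot_fix G (lower_central G (Suc m)) (group_center G)"
proof
  fix b assume b: "b \<in> Aut_class G m"
  then have aut: "b \<in> auto G" by (simp add: Aut_class_def)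
  have ex: "\<exists>x \<in> lower_central G m. x \<in> carrier G \<and> b g = inv x \<otimes> g \<otimes> x"
    if "g \<in> carrier G" for g
    using b that subgroup.mem_carrier[OF subgroup_lower_central]
    unfolding Aut_class_def by blast
  have "b g \<otimes> inv g \<in> lower_central G (Suc m)" if g: "g \<in> carrier G" for g
  proof -
    obtain x where x: "x \<in> lower_central G m" "x \<in> carrier G" "b g = inv x \<otimes> g \<otimes> x"
      using ex g by blast
    have "inv x \<in> lower_central G m"
      using x(1) subgroup_lower_central by (blast intro: subgroup.m_inv_closed)
    from commutator_in_lower_central[OF this g m] show ?thesis using x by simp
  qed
  moreover have "b z = z" if z: "z \<in> group_center G" for z
  proof -
    have zc: "z \<in> carrier G" using z by (simp add: group_center_def)
    obtain x where x: "x \<in> carrier G" "b z = inv x \<otimes> z \<otimes> x" using ex zc by blast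
    have "z \<otimes> x = x \<otimes> z" using z x by (simp add: group_center_def)
    then have "b z = inv x \<otimes> (x \<otimes> z)" using x zc by (simp add: m_assoc)
    then show ?thesis using x zc by (simp add: m_assoc[symmetric])
  qed
  ultimately show "b \<in> Aut_quot_fix G (lower_central G (Suc m)) (group_center G)"
    using aut by (simp add: Aut_quot_fix_def Aut_fix_def Aut_quot_eq subgroup_lower_central)
qed

end

text \<open>Terms at index \<open>Suc (Suc k)\<close> stay folded, so that
  \<open>lower_central_factor\<close> can rewrite them.\<close>

declare lower_central.simps(3) [simp del]

section \<open>Direct products with an abelian factor\<close>

locale abelian_direct_factor = group G for G (structure) +
  fixes H A :: "'a set"
  assumes direct: "internal_direct_product G H A"
    and abelian: "comm_group (G\<lparr>carrier := A\<rparr>)"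
begin

abbreviation GH where "GH \<equiv> G\<lparr>carrier := H\<rparr>"

section \<open>The decomposition of G as a product of H and A\<close>

lemma normal_H: "H \<lhd> G" and normal_A: "A \<lhd> G"
  and disjoint: "H \<inter> A = {\<one>}" and product: "H <#> A = carrier G"
  using direct by (auto simp: internal_direct_product_def)

lemma subgroup_H: "subgroup H G" and subgroup_A: "subgroup A G"
  using normal_H normal_A by (auto intro: normal_imp_subgroup)

sublocale GH: group GH
  by (rule subgroup_imp_group[OF subgroup_H])

lemma H_carrier: "h \<in> H \<Longrightarrow> h \<in> carrier G" and A_carrier: "a \<in> A \<Longrightarrow> a \<in> carrier G"
  using subgroup_H subgroup_A by (blast intro: subgroup.mem_carrier)+

lemma H_closed:
  "\<one> \<in> H" "h \<in> H \<Longrightarrow> h' \<in> H \<Longrightarrow> h \<otimes> h' \<in> H" "h \<in> H \<Longrightarrow> inv h \<in> H"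
  using subgroup_H
  by (blast intro: subgroup.one_closed subgroup.m_closed subgroup.m_inv_closed)+

lemma A_closed:
  "\<one> \<in> A" "a \<in> A \<Longrightarrow> a' \<in> A \<Longrightarrow> a \<otimes> a' \<in> A" "a \<in> A \<Longrightarrow> inv a \<in> A"
  using subgroup_A
  by (blast intro: subgroup.one_closed subgroup.m_closed subgroup.m_inv_closed)+

lemma inv_GH: "h \<in> H \<Longrightarrow> inv\<^bsub>GH\<^esub> h = inv h"
  using subgroup_H by (rule m_inv_consistent)

lemma decompose:
  assumes "g \<in> carrier G"
  obtains h a where "h \<in> H" "a \<in> A" "g = h \<otimes> a"
  using assms product unfolding set_mult_def by blast

lemma decompose_unique:
  assumes "h \<in> H" "a \<in> A" "h' \<in> H" "a' \<in> A" "h \<otimes> a = h' \<otimes> a'"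
  shows "h = h' \<and> a = a'"
proof -
  interpret group_disjoint_sum G H A
    by (intro group_disjoint_sum.intro is_group subgroup_H subgroup_A)
  show ?thesis using cancel disjoint assms by auto
qed

section \<open>Calculating modulo the central factor A\<close>

lemma A_central:
  assumes g: "g \<in> carrier G" and a: "a \<in> A"
  shows "g \<otimes> a = a \<otimes> g"
proof -
  interpret A: comm_group "G\<lparr>carrier := A\<rparr>" by (rule abelian)
  obtain h a' where ha: "h \<in> H" "a' \<in> A" "g = h \<otimes> a'" using g by (rule decompose)
  have "a' \<otimes> a = a \<otimes> a'" using A.m_comm ha a by simp
  \<comment> \<open>Normal subgroups with trivial intersection commute elementwise.\<close>
  moreover have "h \<otimes> a = a \<otimes> h"
    using normal_imp_commuting[OF normal_H normal_A] disjoint ha a by blast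
  ultimately show ?thesis using ha a H_carrier A_carrier by (metis m_assoc)
qed

lemma mult_central:
  assumes "x \<in> carrier G" "y \<in> carrier G" "a \<in> A" "a' \<in> A"
  shows "(x \<otimes> a) \<otimes> (y \<otimes> a') = (x \<otimes> y) \<otimes> (a \<otimes> a')"
proof -
  have a: "a \<in> carrier G" "a' \<in> carrier G" using assms A_carrier by auto
  have "(x \<otimes> a) \<otimes> (y \<otimes> a') = x \<otimes> (a \<otimes> y) \<otimes> a'" using assms a by (simp add: m_assoc)
  also have "a \<otimes> y = y \<otimes> a" using A_central assms by simp
  finally show ?thesis using assms a by (simp add: m_assoc)
qed

lemma conj_central:
  assumes "g \<in> carrier G" "y \<in> carrier G" "a \<in> A"
  shows "inv (y \<otimes> a) \<otimes> g \<otimes> (y \<otimes> a) = inv y \<otimes> g \<otimes> y"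
proof -
  have a: "a \<in> carrier G" using assms A_carrier by blast
  have "inv (y \<otimes> a) \<otimes> g \<otimes> (y \<otimes> a) = inv a \<otimes> ((inv y \<otimes> g \<otimes> y) \<otimes> a)"
    using assms a by (simp add: inv_mult_group m_assoc)
  also have "(inv y \<otimes> g \<otimes> y) \<otimes> a = a \<otimes> (inv y \<otimes> g \<otimes> y)"
    using assms by (intro A_central) auto
  finally show ?thesis using assms a by (simp add: m_assoc[symmetric])
qed

text \<open>Collecting the \<open>A\<close>-parts by \<open>mult_central\<close> leaves the
  commutator of \<open>a\<close> and \<open>a'\<close>, which is trivial.\<close>

lemma commutator_central:
  assumes "x \<in> carrier G" "y \<in> carrier G" "a \<in> A" "a' \<in> A"
  shows "(x \<otimes> a) \<otimes> (y \<otimes> a') \<otimes> inv (x \<otimes> a) \<otimes> inv (y \<otimes> a') = x \<otimes> y \<otimes> inv x \<otimes> inv y"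
proof -
  have a: "a \<in> carrier G" "a' \<in> carrier G" using assms A_carrier by auto
  have inv: "inv (z \<otimes> b) = inv z \<otimes> inv b" if "z \<in> carrier G" "b \<in> A" for z b
    using that A_carrier A_central[of "inv z" "inv b"] A_closed(3) by (simp add: inv_mult_group)
  have "a \<otimes> a' \<otimes> inv a \<otimes> inv a' = a \<otimes> a' \<otimes> inv (a \<otimes> a')"
    using inv[of a a'] assms a by (simp add: m_assoc del: r_inv)
  then have "a \<otimes> a' \<otimes> inv a \<otimes> inv a' = \<one>" using a by simp
  then show ?thesis
    using assms a A_closed mult_central[of x y a a']
      mult_central[of "x \<otimes> y" "inv x" "a \<otimes> a'" "inv a"]
      mult_central[of "x \<otimes> y \<otimes> inv x" "inv y" "a \<otimes> a' \<otimes> inv a" "inv a'"]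
    by (simp add: inv)
qed

section \<open>The lower central series of G and of H\<close>

text \<open>The two sets of generating commutators already coincide, since \<open>A\<close>-parts
  cancel. Intended for \<open>M\<close> = \<gamma>_m(H) and \<open>K\<close> = \<gamma>_m(G), as the
  induction step for the lower central series.\<close>

lemma commutator_subgroup_factor:
  assumes M: "M \<subseteq> H" "M \<subseteq> K" and K: "K \<subseteq> M <#> A"
  shows "commutator_subgroup GH M H = commutator_subgroup G K (carrier G)"
proof -
  let ?c = "\<lambda>x y. x \<otimes> y \<otimes> inv x \<otimes> inv y"
  have "(\<Union>x\<in>M. \<Union>y\<in>H. {?c x y}) = (\<Union>x\<in>K. \<Union>y\<in>carrier G. {?c x y})" (is "?L = ?R")
  proof
    show "?L \<subseteq> ?R" using M H_carrier by blast
    show "?R \<subseteq> ?L"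
    proof
      fix z assume "z \<in> ?R"
      then obtain x y where xy: "x \<in> K" "y \<in> carrier G" "z = ?c x y" by blast
      obtain m a where m: "m \<in> M" "a \<in> A" "x = m \<otimes> a"
        using xy K unfolding set_mult_def by blast
      obtain h a' where h: "h \<in> H" "a' \<in> A" "y = h \<otimes> a'" using xy(2) by (rule decompose)
      have "z = ?c m h"
        using commutator_central[of m h a a'] m h xy M H_carrier by blast
      then show "z \<in> ?L" using m h by blast
    qed
  qed
  \<comment> \<open>Commutators of elements of \<open>H\<close> are the same in \<open>GH\<close>
    and in G, and they lie in \<open>H\<close>, so they generate the same subgroup in both
    groups.\<close>
  moreover have "(\<Union>x\<in>M. \<Union>y\<in>H. {x \<otimes>\<^bsub>GH\<^esub> y \<otimes>\<^bsub>GH\<^esub> inv\<^bsub>GH\<^esub> x \<otimes>\<^bsub>GH\<^esub> inv\<^bsub>GH\<^esub> y}) = ?L"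
    using M inv_GH by (intro SUP_cong) (auto simp: subset_iff)
  moreover have "?L \<subseteq> H" using M H_closed by auto
  ultimately show ?thesis
    unfolding commutator_subgroup_def by (simp only: generate_consistent[OF _ subgroup_H])
qed

text \<open>At index 1 the terms are H and G = HA, so only the bounds are available to start the
  induction. They force equality at the next index, and equality gives the bounds again.\<close>

lemma lower_central_factor_bounds:
  "lower_central GH m \<subseteq> lower_central G m \<and> lower_central G m \<subseteq> lower_central GH m <#> A"
  and lower_central_factor: "lower_central GH (Suc (Suc k)) = lower_central G (Suc (Suc k))"
proof -
  have *: "lower_central GH (Suc (Suc k)) = lower_central G (Suc (Suc k))"
    if "lower_central GH (Suc k) \<subseteq> lower_central G (Suc k)"
      "lower_central G (Suc k) \<subseteq> lower_central GH (Suc k) <#> A" for k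
    using commutator_subgroup_factor[OF _ that]
      GH.subgroup_lower_central[of "Suc k", THEN subgroup.subset]
    by (simp add: lower_central.simps(3))
  have le: "K \<subseteq> K <#> A" if "K \<subseteq> carrier G" for K
    using that A_closed(1) r_one unfolding set_mult_def by force
  have b: "lower_central GH (Suc m) \<subseteq> lower_central G (Suc m)
      \<and> lower_central G (Suc m) \<subseteq> lower_central GH (Suc m) <#> A" for m
  proof (induction m)
    case 0
    show ?case using H_carrier product by auto
  next
    case (Suc m)
    then have "lower_central GH (Suc (Suc m)) = lower_central G (Suc (Suc m))" using * by blast
    then show ?case
      using le subgroup_lower_central[of "Suc (Suc m)", THEN subgroup.subset] by auto
  qed
  \<comment> \<open>At index 0 the dummy value is the whole group, so the bounds are those at index
    1.\<close>
  show "lower_central GH m \<subseteq> lower_central G m \<and> lower_central G m \<subseteq> lower_central GH m <#> A"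
    using b H_carrier product by (cases m) auto
  show "lower_central GH (Suc (Suc k)) = lower_central G (Suc (Suc k))"
    using * b by blast
qed

section \<open>The center\<close>

text \<open>Two decomposed elements commute exactly when their \<open>H\<close>-parts do, because
  their \<open>A\<close>-parts always commute. This amounts to Z(G) = Z(H)A.\<close>

lemma center_decomposed:
  assumes "h \<in> H" "a \<in> A"
  shows "h \<otimes> a \<in> group_center G \<longleftrightarrow> h \<in> group_center GH"
proof
  assume z: "h \<otimes> a \<in> group_center G"
  have "h \<otimes> g = g \<otimes> h" if g: "g \<in> H" for g
  proof -
    \<comment> \<open>Writing \<open>g\<close> as \<open>g \<otimes> \<one>\<close> puts both sides
      in decomposed form, where uniqueness compares the \<open>H\<close>-parts.\<close>
    have "(h \<otimes> a) \<otimes> (g \<otimes> \<one>) = (g \<otimes> \<one>) \<otimes> (h \<otimes> a)"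
      using z g H_carrier by (auto simp: group_center_def)
    then have "(h \<otimes> g) \<otimes> (a \<otimes> \<one>) = (g \<otimes> h) \<otimes> (\<one> \<otimes> a)"
      
      using mult_central[of h g a \<one>] mult_central[of g h \<one> a] assms g A_closed H_carrier by simp
    then show ?thesis using decompose_unique assms g H_closed A_closed by metis
  qed
  then show "h \<in> group_center GH" using assms by (simp add: group_center_def)
next
  assume h: "h \<in> group_center GH"
  have "(h \<otimes> a) \<otimes> g = g \<otimes> (h \<otimes> a)" if g: "g \<in> carrier G" for g
  proof -
    obtain h' a' where g': "h' \<in> H" "a' \<in> A" "g = h' \<otimes> a'" using g by (rule decompose)
    have "h \<otimes> h' = h' \<otimes> h" using h g' by (simp add: group_center_def)
    moreover have "a \<otimes> a' = a' \<otimes> a" using A_central A_carrier assms g' by blast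
    ultimately show ?thesis 
      using g' assms mult_central[of h h' a a'] mult_central[of h' h a' a] H_carrier by simp
  qed
  then show "h \<otimes> a \<in> group_center G"
    using assms H_carrier A_carrier by (simp add: group_center_def)
qed

lemma A_subset_center: "A \<subseteq> group_center G"
  using A_central A_carrier by (auto simp: group_center_def)

lemma center_GH_subset: "group_center GH \<subseteq> group_center G"
proof
  fix h assume h: "h \<in> group_center GH"
  then have "h \<in> H" by (simp add: group_center_def)
  then show "h \<in> group_center G"
    using h center_decomposed[of h \<one>] A_closed(1) H_carrier by simp
qed

section \<open>Restricting to H and extending from H\<close>

definition proj :: "'a \<Rightarrow> 'a" where
  "proj g = (THE h. h \<in> H \<and> (\<exists>a\<in>A. g = h \<otimes> a))"

text \<open>The factor \<open>inv (proj g) \<otimes> g\<close> is the \<open>A\<close>-part of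
  \<open>g\<close>, so this is the map ha \<mapsto> c(h)a. The restricted abstraction supplies the
  extensionality that \<open>auto\<close> demands.\<close>

definition extend :: "('a \<Rightarrow> 'a) \<Rightarrow> 'a \<Rightarrow> 'a" where
  "extend c = (\<lambda>g \<in> carrier G. c (proj g) \<otimes> (inv (proj g) \<otimes> g))"

lemma proj_decomposed:
  assumes "h \<in> H" "a \<in> A"
  shows "proj (h \<otimes> a) = h"
  unfolding proj_def using assms decompose_unique by (intro the_equality) blast+

lemma extend_decomposed:
  assumes "h \<in> H" "a \<in> A"
  shows "extend c (h \<otimes> a) = c h \<otimes> a"
  using assms H_carrier A_carrier
  by (simp add: extend_def proj_decomposed m_assoc[symmetric])

lemma autoD:
  assumes "b \<in> auto G"
  shows "b \<in> extensional (carrier G)" "inj_on b (carrier G)"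
    "\<And>x y. x \<in> carrier G \<Longrightarrow> y \<in> carrier G \<Longrightarrow> b (x \<otimes> y) = b x \<otimes> b y"
  using assms by (auto simp: auto_def Bij_def bij_betw_def hom_def)

lemma auto_GH_D:
  assumes "c \<in> auto GH"
  shows "c \<in> extensional H" "inj_on c H" "c ` H = H" "\<And>h. h \<in> H \<Longrightarrow> c h \<in> H"
    "\<And>x y. x \<in> H \<Longrightarrow> y \<in> H \<Longrightarrow> c (x \<otimes> y) = c x \<otimes> c y"
  using assms by (auto simp: auto_def Bij_def bij_betw_def hom_def)

lemma restrict_auto:
  assumes b: "b \<in> auto G" and bH: "b ` H = H"
  shows "restrict b H \<in> auto GH"
proof -
  have "inj_on b H" using autoD(2)[OF b] H_carrier by (blast intro: inj_on_subset)
  moreover have "b h \<in> H" if "h \<in> H" for h using that bH by blast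
  ultimately show ?thesis
    using autoD(3)[OF b] bH H_carrier H_closed
    by (auto simp: auto_def Bij_def bij_betw_def hom_def)
qed

text \<open>In coordinates this is \<open>c\<close> on \<open>H\<close> times the identity on
  \<open>A\<close>. Centrality of \<open>A\<close> makes it multiplicative, and bijectivity is
  inherited from \<open>c\<close> through the unique decomposition.\<close>

lemma extend_auto:
  assumes c: "c \<in> auto GH"
  shows "extend c \<in> auto G"
proof -
  note cD = auto_GH_D[OF c]
  have car: "extend c g \<in> carrier G" if g: "g \<in> carrier G" for g
  proof -
    obtain h a where ha: "h \<in> H" "a \<in> A" "g = h \<otimes> a" using g by (rule decompose)
    then show ?thesis using cD(4) H_carrier A_carrier by (simp add: extend_decomposed)
  qed
  have mult: "extend c (x \<otimes> y) = extend c x \<otimes> extend c y"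
    if xy: "x \<in> carrier G" "y \<in> carrier G" for x y
  proof -
    obtain h a where ha: "h \<in> H" "a \<in> A" "x = h \<otimes> a" using xy(1) by (rule decompose)
    obtain h' a' where ha': "h' \<in> H" "a' \<in> A" "y = h' \<otimes> a'" using xy(2) by (rule decompose)
    show ?thesis
      using ha ha' cD(4,5) H_closed A_closed H_carrier mult_central[of h h' a a']
        mult_central[of "c h" "c h'" a a']
      by (simp add: extend_decomposed)
  qed
  have "inj_on (extend c) (carrier G)"
  proof (rule inj_onI)
    fix x y assume xy: "x \<in> carrier G" "y \<in> carrier G" "extend c x = extend c y"
    obtain h a where ha: "h \<in> H" "a \<in> A" "x = h \<otimes> a" using xy(1) by (rule decompose)
    obtain h' a' where ha': "h' \<in> H" "a' \<in> A" "y = h' \<otimes> a'" using xy(2) by (rule decompose)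
    have "c h \<otimes> a = c h' \<otimes> a'" using xy(3) ha ha' by (simp add: extend_decomposed)
    then have "c h = c h' \<and> a = a'" using decompose_unique cD(4) ha ha' by blast
    then show "x = y" using cD(2) ha ha' by (auto dest: inj_onD)
  qed
  moreover have "extend c ` carrier G = carrier G"
  proof
    show "extend c ` carrier G \<subseteq> carrier G" using car by blast
    show "carrier G \<subseteq> extend c ` carrier G"
    proof
      fix y assume "y \<in> carrier G"
      then obtain h a where ha: "h \<in> H" "a \<in> A" "y = h \<otimes> a" by (rule decompose)
      obtain h' where h': "h' \<in> H" "h = c h'" using cD(3) ha by blast
      then have "y = extend c (h' \<otimes> a)" using ha by (simp add: extend_decomposed)
      then show "y \<in> extend c ` carrier G" using h' ha H_carrier A_carrier by blast
    qed
  qed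
  ultimately show ?thesis
    using car mult by (auto simp: auto_def Bij_def bij_betw_def hom_def extend_def)
qed

lemma restrict_extend:
  assumes c: "c \<in> auto GH"
  shows "restrict (extend c) H = c"
proof
  fix h show "restrict (extend c) H h = c h"
  proof (cases "h \<in> H")
    case True
    then have "extend c (h \<otimes> \<one>) = c h \<otimes> \<one>" using A_closed(1) by (rule extend_decomposed)
    then show ?thesis using True H_carrier auto_GH_D(4)[OF c] by simp
  next
    case False
    \<comment> \<open>Outside \<open>H\<close> both sides are \<open>undefined\<close>.\<close>
    then show ?thesis using auto_GH_D(1)[OF c] by (simp add: extensional_def)
  qed
qed

section \<open>Automorphisms trivial modulo the lower central term and on the center\<close>

lemma Aut_quot_fix_iff:
  "b \<in> Aut_quot_fix G (lower_central G m) (group_center G) \<longleftrightarrow>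
     b \<in> auto G \<and> (\<forall>g \<in> carrier G. b g \<otimes> inv g \<in> lower_central G m)
       \<and> (\<forall>z \<in> group_center G. b z = z)"
  by (auto simp: Aut_quot_fix_def Aut_fix_def Aut_quot_eq subgroup_lower_central)

lemma Aut_quot_fix_GH_iff:
  "c \<in> Aut_quot_fix GH (lower_central GH m) (group_center GH) \<longleftrightarrow>
     c \<in> auto GH \<and> (\<forall>h \<in> H. c h \<otimes> inv h \<in> lower_central GH m)
       \<and> (\<forall>z \<in> group_center GH. c z = z)"
  by (auto simp: Aut_quot_fix_def Aut_fix_def GH.Aut_quot_eq GH.subgroup_lower_central inv_GH)

text \<open>From index 2 on, \<gamma>_n(G) = \<gamma>_n(H) lies in \<open>H\<close>, so
  \<open>b\<close> also acts trivially modulo \<open>H\<close>, and such maps preserve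
  \<open>H\<close> by definition of \<open>Aut_quot\<close>.\<close>

lemma Aut_quot_fix_image_H:
  assumes b: "b \<in> Aut_quot_fix G (lower_central G (Suc (Suc k))) (group_center G)"
  shows "b ` H = H"
proof -
  have "lower_central G (Suc (Suc k)) \<subseteq> H"
    using GH.subgroup_lower_central[THEN subgroup.subset] lower_central_factor by auto
  then have "b \<in> Aut_quot G H"
    using b by (auto simp: Aut_quot_fix_iff Aut_quot_eq subgroup_H)
  then show ?thesis by (simp add: Aut_quot_def)
qed

lemma restrict_Aut_quot_fix:
  assumes b: "b \<in> Aut_quot_fix G (lower_central G (Suc (Suc k))) (group_center G)"
  shows "restrict b H \<in> Aut_quot_fix GH (lower_central GH (Suc (Suc k))) (group_center GH)"
proof -
  have "restrict b H \<in> auto GH"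
    using restrict_auto Aut_quot_fix_image_H[OF b] b by (simp add: Aut_quot_fix_iff)
  moreover have "group_center GH \<subseteq> H" by (auto simp: group_center_def)
  ultimately show ?thesis
    using b center_GH_subset H_carrier
    unfolding Aut_quot_fix_GH_iff by (auto simp: Aut_quot_fix_iff lower_central_factor)
qed

lemma extend_Aut_quot_fix:
  assumes c: "c \<in> Aut_quot_fix GH (lower_central GH (Suc (Suc k))) (group_center GH)"
  shows "extend c \<in> Aut_quot_fix G (lower_central G (Suc (Suc k))) (group_center G)"
  unfolding Aut_quot_fix_iff
proof (intro conjI ballI)
  have aut: "c \<in> auto GH" using c by (simp add: Aut_quot_fix_GH_iff)
  then show "extend c \<in> auto G" by (rule extend_auto)
  fix g assume g: "g \<in> carrier G"
  obtain h a where ha: "h \<in> H" "a \<in> A" "g = h \<otimes> a" using g by (rule decompose)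
  have car: "h \<in> carrier G" "a \<in> carrier G" "c h \<in> carrier G"
    using ha auto_GH_D(4)[OF aut] H_carrier A_carrier by auto
  \<comment> \<open>The \<open>A\<close>-part cancels: c(h) a times the inverse of ha.\<close>
  have "extend c g \<otimes> inv g = c h \<otimes> inv h"
    using ha car
    by (simp add: extend_decomposed inv_mult_group m_assoc) (simp flip: m_assoc)
  then show "extend c g \<otimes> inv g \<in> lower_central G (Suc (Suc k))"
    using c ha unfolding Aut_quot_fix_GH_iff by (simp add: lower_central_factor)
next
  fix z assume z: "z \<in> group_center G"
  then have "z \<in> carrier G" by (simp add: group_center_def)
  then obtain h a where ha: "h \<in> H" "a \<in> A" "z = h \<otimes> a" by (rule decompose)
  \<comment> \<open>The \<open>H\<close>-part of a central element is central in \<open>H\<close>,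
    hence fixed by \<open>c\<close>.\<close>
  then have "h \<in> group_center GH" using z center_decomposed by blast
  then have "c h = h" using c by (simp add: Aut_quot_fix_GH_iff)
  then show "extend c z = z" using ha by (simp add: extend_decomposed)
qed

section \<open>Class preserving automorphisms\<close>

lemma restrict_Aut_class:
  assumes b: "b \<in> Aut_class G (Suc k)"
  shows "restrict b H \<in> Aut_class GH (Suc k)"
proof -
  \<comment> \<open>Membership in the larger group is what makes the restriction an automorphism of
    \<open>H\<close>.\<close>
  have bq: "b \<in> Aut_quot_fix G (lower_central G (Suc (Suc k))) (group_center G)"
    using b Aut_class_subset_Aut_quot_fix[of "Suc k"] by auto
  have "restrict b H \<in> auto GH"
    using restrict_Aut_quot_fix[OF bq] by (simp add: Aut_quot_fix_GH_iff)
  moreover have "\<exists>y \<in> lower_central GH (Suc k). restrict b H h = inv\<^bsub>GH\<^esub> y \<otimes> h \<otimes> y"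
    if h: "h \<in> H" for h
  proof -
    obtain x where x: "x \<in> lower_central G (Suc k)" "b h = inv x \<otimes> h \<otimes> x"
      using b h H_carrier unfolding Aut_class_def by blast
    \<comment> \<open>The conjugating element \<open>x\<close> may lie outside \<open>H\<close> (for
      \<open>k = 0\<close> it ranges over all of G). It is replaced by its \<open>H\<close>-part, as
      the central factor \<open>a\<close> does not affect conjugation.\<close>
    obtain y a where y: "y \<in> lower_central GH (Suc k)" "a \<in> A" "x = y \<otimes> a"
      using x(1) lower_central_factor_bounds[of "Suc k"] unfolding set_mult_def by blast
    have yH: "y \<in> H" using y(1) GH.subgroup_lower_central subgroup.mem_carrier by fastforce
    have "b h = inv y \<otimes> h \<otimes> y"
      using x(2) y yH h H_carrier conj_central by simp
    then show ?thesis using y(1) yH h inv_GH by (intro bexI[of _ y]) auto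
  qed
  ultimately show ?thesis by (simp add: Aut_class_def)
qed

text \<open>An element conjugating \<open>h\<close> to \<open>c h\<close> also conjugates
  \<open>h \<otimes> a\<close> to \<open>c h \<otimes> a\<close>, because \<open>a\<close> is
  central.\<close>

lemma extend_Aut_class:
  assumes c: "c \<in> Aut_class GH m"
  shows "extend c \<in> Aut_class G m"
proof -
  have aut: "c \<in> auto GH" using c by (simp add: Aut_class_def)
  have "\<exists>x \<in> lower_central G m. extend c g = inv x \<otimes> g \<otimes> x" if g: "g \<in> carrier G" for g
  proof -
    obtain h a where ha: "h \<in> H" "a \<in> A" "g = h \<otimes> a" using g by (rule decompose)
    obtain x where x: "x \<in> lower_central GH m" "c h = inv\<^bsub>GH\<^esub> x \<otimes> h \<otimes> x"
      using c ha by (auto simp: Aut_class_def)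
    have xH: "x \<in> H" using x(1) GH.subgroup_lower_central subgroup.mem_carrier by fastforce
    have car: "h \<in> carrier G" "a \<in> carrier G" "x \<in> carrier G"
      using ha xH H_carrier A_carrier by auto
    have "extend c g = inv x \<otimes> h \<otimes> (x \<otimes> a)"
      using ha x xH car by (simp add: extend_decomposed inv_GH m_assoc)
    also have "x \<otimes> a = a \<otimes> x" using A_central car ha by blast
    finally have "extend c g = inv x \<otimes> g \<otimes> x" using ha car by (simp add: m_assoc)
    then show ?thesis using x(1) lower_central_factor_bounds by blast
  qed
  then show ?thesis using extend_auto[OF aut] by (simp add: Aut_class_def)
qed

section \<open>Restriction as an isomorphism\<close>

text \<open>The fixed center contains \<open>A\<close>, so such automorphisms are determined by
  their values on \<open>H\<close>.\<close>

lemma restrict_inj: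
  "inj_on (\<lambda>b. restrict b H)
     (Aut_quot_fix G (lower_central G (Suc (Suc k))) (group_center G))"
proof (rule inj_onI)
  fix b b'
  assume b: "b \<in> Aut_quot_fix G (lower_central G (Suc (Suc k))) (group_center G)"
    and b': "b' \<in> Aut_quot_fix G (lower_central G (Suc (Suc k))) (group_center G)"
    and eq: "restrict b H = restrict b' H"
  have "b g = b' g" if g: "g \<in> carrier G" for g
  proof -
    obtain h a where ha: "h \<in> H" "a \<in> A" "g = h \<otimes> a" using g by (rule decompose)
    have "b h = b' h" using eq ha by (metis restrict_apply')
    moreover have "b a = a" "b' a = a" using b b' ha A_subset_center
      by (auto simp: Aut_quot_fix_iff)
    ultimately show ?thesis
      using ha autoD(3)[of b h a] autoD(3)[of b' h a] b b' H_carrier A_carrier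
      by (simp add: Aut_quot_fix_iff)
  qed
  moreover have "b \<in> extensional (carrier G)" "b' \<in> extensional (carrier G)"
    using autoD(1) b b' by (auto simp: Aut_quot_fix_iff)
  ultimately show "b = b'" by (blast intro: extensionalityI)
qed

lemma restrict_iso:
  "(\<lambda>b. restrict b H) \<in> iso
     ((AutoGroup G)\<lparr>carrier :=
        Aut_quot_fix G (lower_central G (Suc (Suc k))) (group_center G)\<rparr>)
     ((AutoGroup GH)\<lparr>carrier :=
        Aut_quot_fix GH (lower_central GH (Suc (Suc k))) (group_center GH)\<rparr>)"
    (is "?r \<in> iso (_\<lparr>carrier := ?X\<rparr>) (_\<lparr>carrier := ?Y\<rparr>)")
proof -
  have r: "?r b \<in> ?Y" if "b \<in> ?X" for b using that by (rule restrict_Aut_quot_fix)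
  \<comment> \<open>The product of \<open>BijGroup\<close> is a function restricted to
    \<open>Bij\<close>, so membership there is required before it unfolds to
    \<open>compose\<close>.\<close>
  have BG: "b \<in> Bij (carrier G)" if "b \<in> ?X" for b
    using that by (auto simp: Aut_quot_fix_iff auto_def)
  have BH: "c \<in> Bij H" if "c \<in> ?Y" for c
    using that by (auto simp: Aut_quot_fix_GH_iff auto_def)
  \<comment> \<open>Restriction respects composition because the inner map \<open>b'\<close> sends
    \<open>H\<close> into \<open>H\<close>.\<close>
  have "?r (compose (carrier G) b b') = compose H (?r b) (?r b')"
    if b: "b \<in> ?X" "b' \<in> ?X" for b b'
  proof
    fix h show "?r (compose (carrier G) b b') h = compose H (?r b) (?r b') h"
      using Aut_quot_fix_image_H[OF b(2)] H_carrier by (auto simp: compose_def)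
  qed
  moreover have "?r ` ?X = ?Y"
  proof
    show "?r ` ?X \<subseteq> ?Y" using r by blast
    show "?Y \<subseteq> ?r ` ?X"
    proof
      fix c assume c: "c \<in> ?Y"
      then have "c = ?r (extend c)" by (simp add: Aut_quot_fix_GH_iff restrict_extend)
      then show "c \<in> ?r ` ?X" using extend_Aut_quot_fix[OF c] by blast
    qed
  qed
  ultimately show ?thesis
    using r BG BH restrict_inj
    by (simp add: iso_def hom_def bij_betw_def AutoGroup_def BijGroup_def)
qed

lemma restrict_image_Aut_class:
  "(\<lambda>b. restrict b H) ` Aut_class G (Suc k) = Aut_class GH (Suc k)"
proof
  show "(\<lambda>b. restrict b H) ` Aut_class G (Suc k) \<subseteq> Aut_class GH (Suc k)"
    using restrict_Aut_class by blast
  show "Aut_class GH (Suc k) \<subseteq> (\<lambda>b. restrict b H) ` Aut_class G (Suc k)"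
  proof
    fix c assume c: "c \<in> Aut_class GH (Suc k)"
    then have "c = restrict (extend c) H" by (simp add: Aut_class_def restrict_extend)
    then show "c \<in> (\<lambda>b. restrict b H) ` Aut_class G (Suc k)"
      using extend_Aut_class[OF c] by blast
  qed
qed

end

theorem theorem3p2:
  fixes G :: "('a, 'b) monoid_scheme" and H A :: "'a set" and n :: nat
  assumes "group G"
    and "internal_direct_product G H A"
    and "purely_nonabelian (G\<lparr>carrier := H\<rparr>)"
    and "comm_group (G\<lparr>carrier := A\<rparr>)"
    and "A \<noteq> {\<one>\<^bsub>G\<^esub>}"
    and "n \<ge> 2"
  shows "\<exists>\<phi> \<in> iso
      ((AutoGroup G)\<lparr>carrier := Aut_quot_fix G (lower_central G n) (group_center G)\<rparr>)
      ((AutoGroup (G\<lparr>carrier := H\<rparr>))\<lparr>carrier :=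
         Aut_quot_fix (G\<lparr>carrier := H\<rparr>) (lower_central (G\<lparr>carrier := H\<rparr>) n)
           (group_center (G\<lparr>carrier := H\<rparr>))\<rparr>).
      \<phi> ` Aut_class G (n - 1) = Aut_class (G\<lparr>carrier := H\<rparr>) (n - 1)"
proof -
  interpret group G by (rule assms)
  interpret abelian_direct_factor G H A
    by (intro abelian_direct_factor.intro abelian_direct_factor_axioms.intro assms)
  \<comment> \<open>With this \<open>k\<close>, the index \<open>n - 1\<close> of the class
    preserving groups is \<open>Suc k\<close>.\<close>
  obtain k where "n = Suc (Suc k)"
    using assms(6) by (metis add_2_eq_Suc le_Suc_ex)
  then show ?thesis
    using restrict_iso[of k] restrict_image_Aut_class[of k] by auto
qed

end
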